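(* Let $X(x):\mathbb{R}^m\to T_xM$, $x\in M$, be linear, surjective and $C^\infty$ in $x$, let $M$ carry the induced Riemannian metric with Levi-Civita connection $\nabla$, and let $\breve\nabla$ be the connection $\breve\nabla Z(v)=X(x)(d[Y(\cdot)Z(\cdot)](v))$, $v\in T_xM$. For $x_0\in M$ and $v\in T_{x_0}M$ let $Z^v$ be the vector field $Z^v(x)=X(x)Y(x_0)v$. Then: 1. $\breve\nabla$ is the Levi-Civita connection if and only if, for all $x_0\in M$ and $v\in T_{x_0}M$, $\nabla Z^v$ vanishes at $x_0$. 2. $\breve\nabla$ is torsion skew symmetric if and only if for all $x_0\in M$ and $v\in T_{x_0}M$ the map $\nabla Z^v|_{T_{x_0}M}:T_{x_0}M\to T_{x_0}M$, $u\mapsto\nabla_uZ^v$, is skew symmetric; or equivalently, if and only if $\nabla_vZ^w+\nabla_wZ^v=0$ for all $v,w\in T_{x}M$ and all $x\in M$; or equivalently, if and only if $\breve\nabla_UV+\breve\nabla_VU=\nabla_UV+\nabla_VU$ for all smooth vector fields $U,V$ on $M$. Also, $\breve\nabla$ is the Levi-Civita connection if and only if $X(x)\,dY(u,v)=0$ for all $u,v\in T_xM$ and all $x\in M$.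
   Context: $M$ is a $C^\infty$ manifold. For $e\in\mathbb{R}^m$, $X^e$ is the vector field $X^e(x)=X(x)(e)$. The induced Riemannian metric $\langle\cdot,\cdot\rangle_x$ on $T_xM$ is the one for which $X(x)$ restricted to $[\ker X(x)]^\perp$ is an isometry onto $T_xM$; $Y(x):T_xM\to\mathbb{R}^m$ is the adjoint of $X(x)$. $Y$ is regarded as an $\mathbb{R}^m$-valued 1-form on $M$ and $dY$ is its exterior derivative. The torsion of a connection $\tilde\nabla$ is $\tilde T(U,V)=\tilde\nabla_UV-\tilde\nabla_VU-[U,V]$. A connection $\tilde\nabla$ on a Riemannian manifold is called torsion skew symmetric if, for all $x_0\in M$ and $v\in T_{x_0}M$, the linear map $u\mapsto\tilde T(u,v)$ of $T_{x_0}M$ to itself is skew symmetric. *)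

theory Defs
  imports "HOL-Analysis.Analysis" "HOL-Library.Function_Algebras"
begin

instantiation "fun" :: (type, real_vector) real_vector
begin

definition scaleR_fun :: "real \<Rightarrow> ('a \<Rightarrow> 'b) \<Rightarrow> 'a \<Rightarrow> 'b" where
  "scaleR_fun c f = (\<lambda>x. c *\<^sub>R f x)"

instance
  by standard (simp_all add: scaleR_fun_def fun_eq_iff algebra_simps)

end

lemma scaleR_fun_apply [simp]: "(c *\<^sub>R f) x = c *\<^sub>R f x"
  by (simp add: scaleR_fun_def)


section \<open>Smooth manifolds\<close>

text \<open>Differentiability of class \<open>C\<^sup>k\<close>; only meant for open \<open>S\<close>.\<close>

primrec Ck_on :: "nat \<Rightarrow> 'a::real_normed_vector set \<Rightarrow> ('a \<Rightarrow> 'b::real_normed_vector) \<Rightarrow> bool" where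
  "Ck_on 0 S f \<longleftrightarrow> continuous_on S f"
| "Ck_on (Suc k) S f \<longleftrightarrow>
     (\<forall>x\<in>S. f differentiable (at x)) \<and> (\<forall>h. Ck_on k S (\<lambda>x. frechet_derivative f (at x) h))"

definition smooth_on :: "'a::real_normed_vector set \<Rightarrow> ('a \<Rightarrow> 'b::real_normed_vector) \<Rightarrow> bool" where
  "smooth_on S f \<longleftrightarrow> (\<forall>k. Ck_on k S f)"

text \<open>The points of the manifold are the elements of a Hausdorff, second countable type. The smooth
  structure is given by an atlas of pairs \<open>(U, \<phi>)\<close>; only the restriction of \<open>\<phi>\<close> to \<open>U\<close> matters.\<close>

type_synonym ('a, 'e) chart = "'a set \<times> ('a \<Rightarrow> 'e)"

locale smooth_manifold =
  fixes A :: "('a::{t2_space, second_countable_topology}, 'e::euclidean_space) chart set"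
  assumes covers: "(\<Union>(U, \<phi>)\<in>A. U) = UNIV"
    and chart: "\<And>U \<phi>. (U, \<phi>) \<in> A \<Longrightarrow>
          open U \<and> open (\<phi> ` U) \<and> homeomorphism U (\<phi> ` U) \<phi> (inv_into U \<phi>)"
    and compatible: "\<And>U \<phi> V \<psi>. (U, \<phi>) \<in> A \<Longrightarrow> (V, \<psi>) \<in> A \<Longrightarrow>
          smooth_on (\<phi> ` (U \<inter> V)) (\<psi> \<circ> inv_into U \<phi>)"

definition smooth_fun :: "('a, 'e::euclidean_space) chart set \<Rightarrow> ('a \<Rightarrow> 'b::real_normed_vector) \<Rightarrow> bool" where
  "smooth_fun A f \<longleftrightarrow> (\<forall>(U, \<phi>)\<in>A. smooth_on (\<phi> ` U) (f \<circ> inv_into U \<phi>))"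


section \<open>Tangent vectors and vector fields\<close>

text \<open>Tangent vectors at \<open>x\<close> are the derivations at \<open>x\<close> of the algebra of smooth real functions. As HOL
  functions are total, a tangent vector is made to vanish on all non-smooth functions, so that two
  derivations agreeing on the smooth functions are equal.\<close>

type_synonym 'a tvec = "('a \<Rightarrow> real) \<Rightarrow> real"

definition tangent_space :: "('a, 'e::euclidean_space) chart set \<Rightarrow> 'a \<Rightarrow> 'a tvec set" where
  "tangent_space A x = {v.
     (\<forall>f g. smooth_fun A f \<longrightarrow> smooth_fun A g \<longrightarrow> v (\<lambda>y. f y + g y) = v f + v g) \<and>
     (\<forall>c f. smooth_fun A f \<longrightarrow> v (\<lambda>y. c * f y) = c * v f) \<and>
     (\<forall>f g. smooth_fun A f \<longrightarrow> smooth_fun A g \<longrightarrow> v (\<lambda>y. f y * g y) = f x * v g + g x * v f) \<and>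
     (\<forall>f. \<not> smooth_fun A f \<longrightarrow> v f = 0)}"

type_synonym 'a vfield = "'a \<Rightarrow> 'a tvec"

definition smooth_vfield :: "('a, 'e::euclidean_space) chart set \<Rightarrow> 'a vfield \<Rightarrow> bool" where
  "smooth_vfield A V \<longleftrightarrow>
     (\<forall>x. V x \<in> tangent_space A x) \<and> (\<forall>f. smooth_fun A f \<longrightarrow> smooth_fun A (\<lambda>x. V x f))"

definition lie_bracket :: "'a vfield \<Rightarrow> 'a vfield \<Rightarrow> 'a vfield" where
  "lie_bracket U V x f = U x (\<lambda>y. V y f) - V x (\<lambda>y. U y f)"

text \<open>The differential \<open>dF(v)\<close> of an \<open>\<real>\<^sup>m\<close>-valued function.\<close>

definition differential :: "('a \<Rightarrow> real^'m) \<Rightarrow> 'a tvec \<Rightarrow> real^'m" where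
  "differential F v = (\<chi> i. v (\<lambda>y. F y $ i))"

text \<open>Exterior derivative of an \<open>\<real>\<^sup>m\<close>-valued 1-form: the common value at \<open>x\<close> of
  \<open>U(\<omega>(V)) - V(\<omega>(U)) - \<omega>([U,V])\<close> over all smooth extensions \<open>U\<close>, \<open>V\<close> of \<open>u\<close>, \<open>v\<close>
  (for a smooth form this does not depend on the extensions; no factor 1/2 is used).\<close>

definition exterior_derivative ::
    "('a, 'e::euclidean_space) chart set \<Rightarrow> ('a \<Rightarrow> 'a tvec \<Rightarrow> real^'m) \<Rightarrow> 'a \<Rightarrow> 'a tvec \<Rightarrow> 'a tvec \<Rightarrow> real^'m" where
  "exterior_derivative A \<omega> x u v = (THE r. \<forall>U V.
     smooth_vfield A U \<longrightarrow> smooth_vfield A V \<longrightarrow> U x = u \<longrightarrow> V x = v \<longrightarrow>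
       r = differential (\<lambda>y. \<omega> y (V y)) u - differential (\<lambda>y. \<omega> y (U y)) v - \<omega> x (lie_bracket U V x))"


section \<open>Connections\<close>

text \<open>\<open>D Z x u\<close> is the covariant derivative of \<open>Z\<close> in the direction \<open>u\<close>, a tangent vector at \<open>x\<close>.\<close>

type_synonym 'a cov_deriv = "'a vfield \<Rightarrow> 'a \<Rightarrow> 'a tvec \<Rightarrow> 'a tvec"

definition connection :: "('a, 'e::euclidean_space) chart set \<Rightarrow> 'a cov_deriv \<Rightarrow> bool" where
  "connection A D \<longleftrightarrow>
     (\<forall>Z x. smooth_vfield A Z \<longrightarrow>
        (\<forall>u\<in>tangent_space A x. D Z x u \<in> tangent_space A x) \<and>
        (\<forall>u\<in>tangent_space A x. \<forall>w\<in>tangent_space A x. D Z x (u + w) = D Z x u + D Z x w) \<and>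
        (\<forall>c. \<forall>u\<in>tangent_space A x. D Z x (c *\<^sub>R u) = c *\<^sub>R D Z x u)) \<and>
     (\<forall>Z W x. smooth_vfield A Z \<longrightarrow> smooth_vfield A W \<longrightarrow>
        (\<forall>u\<in>tangent_space A x. D (\<lambda>y. Z y + W y) x u = D Z x u + D W x u)) \<and>
     (\<forall>f Z x. smooth_fun A f \<longrightarrow> smooth_vfield A Z \<longrightarrow>
        (\<forall>u\<in>tangent_space A x. D (\<lambda>y. f y *\<^sub>R Z y) x u = u f *\<^sub>R Z x + f x *\<^sub>R D Z x u)) \<and>
     (\<forall>U Z. smooth_vfield A U \<longrightarrow> smooth_vfield A Z \<longrightarrow> smooth_vfield A (\<lambda>x. D Z x (U x)))"

definition torsion_field :: "'a cov_deriv \<Rightarrow> 'a vfield \<Rightarrow> 'a vfield \<Rightarrow> 'a vfield" where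
  "torsion_field D U V x = D V x (U x) - D U x (V x) - lie_bracket U V x"

text \<open>The torsion as a tensor: its value on tangent vectors at \<open>x\<close> is the common value over all smooth
  extensions.\<close>

definition torsion :: "('a, 'e::euclidean_space) chart set \<Rightarrow> 'a cov_deriv \<Rightarrow> 'a \<Rightarrow> 'a tvec \<Rightarrow> 'a tvec \<Rightarrow> 'a tvec" where
  "torsion A D x u v = (THE t. \<forall>U V.
     smooth_vfield A U \<longrightarrow> smooth_vfield A V \<longrightarrow> U x = u \<longrightarrow> V x = v \<longrightarrow> t = torsion_field D U V x)"

type_synonym 'a metric = "'a \<Rightarrow> 'a tvec \<Rightarrow> 'a tvec \<Rightarrow> real"

definition metric_connection :: "('a, 'e::euclidean_space) chart set \<Rightarrow> 'a metric \<Rightarrow> 'a cov_deriv \<Rightarrow> bool" where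
  "metric_connection A g D \<longleftrightarrow>
     (\<forall>Z W x. smooth_vfield A Z \<longrightarrow> smooth_vfield A W \<longrightarrow>
        (\<forall>u\<in>tangent_space A x. u (\<lambda>y. g y (Z y) (W y)) = g x (D Z x u) (W x) + g x (Z x) (D W x u)))"

definition levi_civita :: "('a, 'e::euclidean_space) chart set \<Rightarrow> 'a metric \<Rightarrow> 'a cov_deriv \<Rightarrow> bool" where
  "levi_civita A g D \<longleftrightarrow> connection A D \<and> metric_connection A g D \<and>
     (\<forall>U V x. smooth_vfield A U \<longrightarrow> smooth_vfield A V \<longrightarrow> torsion_field D U V x = 0)"

definition skew_symmetric_on :: "'v set \<Rightarrow> ('v \<Rightarrow> 'v \<Rightarrow> real) \<Rightarrow> ('v \<Rightarrow> 'v) \<Rightarrow> bool" where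
  "skew_symmetric_on T b L \<longleftrightarrow> (\<forall>u\<in>T. \<forall>w\<in>T. b (L u) w = - b u (L w))"

definition torsion_skew_symmetric ::
    "('a, 'e::euclidean_space) chart set \<Rightarrow> 'a metric \<Rightarrow> 'a cov_deriv \<Rightarrow> bool" where
  "torsion_skew_symmetric A g D \<longleftrightarrow>
     (\<forall>x. \<forall>v\<in>tangent_space A x. skew_symmetric_on (tangent_space A x) (g x) (\<lambda>u. torsion A D x u v))"


section \<open>Structures induced by a family of surjections \<open>X(x) : \<real>\<^sup>m \<rightarrow> T\<^sub>xM\<close>\<close>

text \<open>The inner product on the image of \<open>X(x)\<close> transported from \<open>[ker X(x)]\<^sup>\<bottom>\<close> along \<open>X(x)\<close>.\<close>

definition induced_metric :: "('a \<Rightarrow> real^'m \<Rightarrow> 'a tvec) \<Rightarrow> 'a metric" where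
  "induced_metric X x u v =
     (let H = orthogonal_comp {e. X x e = 0} in inv_into H (X x) u \<bullet> inv_into H (X x) v)"

definition adjoint_form :: "('a \<Rightarrow> real^'m \<Rightarrow> 'a tvec) \<Rightarrow> 'a \<Rightarrow> 'a tvec \<Rightarrow> real^'m" where
  "adjoint_form X x v = (THE e. \<forall>e'. induced_metric X x (X x e') v = e' \<bullet> e)"

definition breve_connection :: "('a \<Rightarrow> real^'m \<Rightarrow> 'a tvec) \<Rightarrow> 'a cov_deriv" where
  "breve_connection X Z x u = X x (differential (\<lambda>y. adjoint_form X y (Z y)) u)"

text \<open>The vector field \<open>Z\<^sup>v\<close> for \<open>v\<close> tangent at \<open>x\<^sub>0\<close>.\<close>

definition Z_field :: "('a \<Rightarrow> real^'m \<Rightarrow> 'a tvec) \<Rightarrow> 'a \<Rightarrow> 'a tvec \<Rightarrow> 'a vfield" where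
  "Z_field X x\<^sub>0 v = (\<lambda>x. X x (adjoint_form X x\<^sub>0 v))"

end

(* The fields Z^v extend any tangent vector, and the fields X(e_i) globally generate the vector
   fields over the smooth functions, so neither bump functions nor charts are needed for
   tensoriality. Expanding V = sum_i (Y V)_i X(e_i) gives breve_u V = D_u V - S(u, v) at x, where
   v = V(x) and S(u, v) = D_u Z^v. Hence the torsion of the breve connection is S(v, u) - S(u, v).
   Both connections being metric, <S(u, v), w> is skew in v and w; everything then follows by
   permuting the arguments of this trilinear form. For the last equivalence,
   dY(u, v) - Y T(u, v) is seen to depend only on u and v by differentiating Y V = (Y X) Y V,
   and X(x) dY = T. *)

theory Submission
  imports Defs
begin

section \<open>Functions of class \<open>C^k\<close> on open sets\<close>

text \<open>A derivative at a point depends on a whole neighbourhood; as \<open>S\<close> is open,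
  agreement on \<open>S\<close> forces equal derivatives there. The induction generalises both
  functions because it passes to their directional derivatives.\<close>

lemma Ck_on_cong:
  assumes "open S" "\<And>x. x \<in> S \<Longrightarrow> f x = g x" "Ck_on k S f"
  shows "Ck_on k S g"
  using assms(2,3)
proof (induction k arbitrary: f g)
  case 0
  then show ?case
    using continuous_on_cong by (metis Ck_on.simps(1))
next
  case (Suc k)
  have g: "(g has_derivative frechet_derivative f (at x)) (at x)" if "x \<in> S" for x
  proof -
    have "(f has_derivative frechet_derivative f (at x)) (at x)"
      using Suc.prems that by (simp flip: frechet_derivative_works)
    then show ?thesis
      using has_derivative_transform_within_open assms(1) that Suc.prems(1) by blast
  qed
  have "frechet_derivative f (at x) = frechet_derivative g (at x)" if "x \<in> S" for x
    using g[OF that] by (rule frechet_derivative_at)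
  then have "Ck_on k S (\<lambda>x. frechet_derivative g (at x) h)" for h
    using Suc.IH[of "\<lambda>x. frechet_derivative f (at x) h"] Suc.prems by auto
  then show ?case
    using g by (auto simp: differentiable_def)
qed

lemma Ck_on_SucD: "Ck_on (Suc k) S f \<Longrightarrow> Ck_on k S f"
proof (induction k arbitrary: f)
  case 0
  then show ?case
    by (auto intro!: continuous_at_imp_continuous_on differentiable_imp_continuous_within)
next
  case (Suc k)
  then show ?case by (metis Ck_on.simps(2))
qed

lemma Ck_on_const: "Ck_on k S (\<lambda>_. c)"
  by (induction k arbitrary: c) (auto simp: frechet_derivative_const)

text \<open>Lets the derivative be supplied as a formula, such as the product rule, in place of
  \<open>frechet_derivative\<close>; the two agree on \<open>S\<close> by uniqueness.\<close>

lemma Ck_on_SucI: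
  assumes "open S" "\<And>x. x \<in> S \<Longrightarrow> (f has_derivative f' x) (at x)" "\<And>h. Ck_on k S (\<lambda>x. f' x h)"
  shows "Ck_on (Suc k) S f"
proof -
  have "f' x = frechet_derivative f (at x)" if "x \<in> S" for x
    using assms(2)[OF that] by (rule frechet_derivative_at)
  then have "Ck_on k S (\<lambda>x. frechet_derivative f (at x) h)" for h
    by (intro Ck_on_cong[OF assms(1) _ assms(3)[of h]]) auto
  then show ?thesis
    using assms(2) by (auto simp: differentiable_def)
qed

lemma Ck_on_add:
  assumes "open S" "Ck_on k S f" "Ck_on k S g"
  shows "Ck_on k S (\<lambda>x. f x + g x)"
  using assms(2,3)
proof (induction k arbitrary: f g)
  case 0
  then show ?case by (auto intro: continuous_on_add)
next
  case (Suc k)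
  show ?case
  proof (rule Ck_on_SucI[OF assms(1)])
    show "((\<lambda>x. f x + g x) has_derivative
        (\<lambda>h. frechet_derivative f (at x) h + frechet_derivative g (at x) h)) (at x)" if "x \<in> S" for x
      using Suc.prems that
      by (auto intro!: has_derivative_add frechet_derivative_works[THEN iffD1])
  qed (use Suc in auto)
qed

lemma Ck_on_mult:
  fixes f g :: "'a::real_normed_vector \<Rightarrow> 'b::real_normed_algebra"
  assumes "open S" "Ck_on k S f" "Ck_on k S g"
  shows "Ck_on k S (\<lambda>x. f x * g x)"
  using assms(2,3)
proof (induction k arbitrary: f g)
  case 0
  then show ?case by (auto intro: continuous_on_mult)
next
  case (Suc k)
  show ?case
  proof (rule Ck_on_SucI[OF assms(1)])
    show "((\<lambda>x. f x * g x) has_derivative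
        (\<lambda>h. f x * frechet_derivative g (at x) h + frechet_derivative f (at x) h * g x)) (at x)"
      if "x \<in> S" for x
      using Suc.prems that
      by (auto intro!: has_derivative_mult frechet_derivative_works[THEN iffD1])
    show "Ck_on k S (\<lambda>x. f x * frechet_derivative g (at x) h + frechet_derivative f (at x) h * g x)" for h
      \<comment> \<open>The formula contains \<open>f\<close> and \<open>g\<close> undifferentiated,
        so their order is lowered by \<open>Ck_on_SucD\<close>.\<close>
      using Suc.prems by (intro Ck_on_add assms(1) Suc.IH) (auto intro: Ck_on_SucD)
  qed
qed

section \<open>Calculus of tangent vectors, vector fields and connections\<close>

lemma subspace_tangent_space: "subspace (tangent_space A x)"
  by (auto simp: subspace_def tangent_space_def algebra_simps)

lemma tangent_add:
  "v \<in> tangent_space A x \<Longrightarrow> smooth_fun A f \<Longrightarrow> smooth_fun A g \<Longrightarrow> v (\<lambda>y. f y + g y) = v f + v g"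
  by (simp add: tangent_space_def)

lemma tangent_scale:
  "v \<in> tangent_space A x \<Longrightarrow> smooth_fun A f \<Longrightarrow> v (\<lambda>y. c * f y) = c * v f"
  by (simp add: tangent_space_def)

lemma tangent_mult:
  "v \<in> tangent_space A x \<Longrightarrow> smooth_fun A f \<Longrightarrow> smooth_fun A g
    \<Longrightarrow> v (\<lambda>y. f y * g y) = f x * v g + g x * v f"
  by (simp add: tangent_space_def)

lemma tangent_not_smooth: "v \<in> tangent_space A x \<Longrightarrow> \<not> smooth_fun A f \<Longrightarrow> v f = 0"
  by (simp add: tangent_space_def)

lemma connection_add:
  assumes "connection A D" "smooth_vfield A Z" "smooth_vfield A W" "u \<in> tangent_space A x"
  shows "D (\<lambda>y. Z y + W y) x u = D Z x u + D W x u"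
  using assms by (simp add: connection_def)

lemma connection_scale:
  assumes "connection A D" "smooth_fun A f" "smooth_vfield A Z" "u \<in> tangent_space A x"
  shows "D (\<lambda>y. f y *\<^sub>R Z y) x u = u f *\<^sub>R Z x + f x *\<^sub>R D Z x u"
  using assms by (simp add: connection_def)

lemma metric_connectionD:
  assumes "metric_connection A g D" "smooth_vfield A Z" "smooth_vfield A W" "u \<in> tangent_space A x"
  shows "u (\<lambda>y. g y (Z y) (W y)) = g x (D Z x u) (W x) + g x (Z x) (D W x u)"
  using assms by (simp add: metric_connection_def)

lemma sum_fun_apply: "(\<Sum>i\<in>I. f i) x = (\<Sum>i\<in>I. f i x)"
  by (induction I rule: infinite_finite_induct) auto

context smooth_manifold
begin

lemma smooth_fun_const [intro]: "smooth_fun A (\<lambda>_. c)"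
  by (auto simp: smooth_fun_def smooth_on_def o_def Ck_on_const)

lemma smooth_fun_add [intro]:
  "smooth_fun A f \<Longrightarrow> smooth_fun A g \<Longrightarrow> smooth_fun A (\<lambda>x. f x + g x)"
  using chart by (fastforce simp: smooth_fun_def smooth_on_def o_def intro: Ck_on_add)

lemma smooth_fun_mult [intro]:
  fixes f g :: "'a \<Rightarrow> real"
  shows "smooth_fun A f \<Longrightarrow> smooth_fun A g \<Longrightarrow> smooth_fun A (\<lambda>x. f x * g x)"
  using chart by (fastforce simp: smooth_fun_def smooth_on_def o_def intro: Ck_on_mult)

lemma smooth_fun_sum [intro]:
  "(\<And>i. i \<in> I \<Longrightarrow> smooth_fun A (f i)) \<Longrightarrow> smooth_fun A (\<lambda>x. \<Sum>i\<in>I. f i x)"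
  by (induction I rule: infinite_finite_induct) auto

text \<open>The Leibniz rule for \<open>1 * 1\<close> gives \<open>v(1) = 2 v(1)\<close>;
  homogeneity covers the other constants.\<close>

lemma tangent_const:
  assumes "v \<in> tangent_space A x"
  shows "v (\<lambda>_. c) = 0"
proof -
  have "v (\<lambda>_. 1) = 0"
    using tangent_mult[OF assms smooth_fun_const smooth_fun_const, of 1 1] by simp
  then show ?thesis
    using tangent_scale[OF assms smooth_fun_const, of c 1] by simp
qed

lemma tangent_sum:
  assumes "v \<in> tangent_space A x" "\<And>i. i \<in> I \<Longrightarrow> smooth_fun A (f i)"
  shows "v (\<lambda>y. \<Sum>i\<in>I. f i y) = (\<Sum>i\<in>I. v (f i))"
  using assms(2)
  by (induction I rule: infinite_finite_induct)
    (auto simp: tangent_const[OF assms(1)] tangent_add[OF assms(1)] smooth_fun_sum)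

lemma differential_add:
  assumes "u \<in> tangent_space A x" "\<And>i. smooth_fun A (\<lambda>y. F y $ i)" "\<And>i. smooth_fun A (\<lambda>y. G y $ i)"
  shows "differential (\<lambda>y. F y + G y) u = differential F u + differential G u"
  by (simp add: differential_def vec_eq_iff tangent_add[OF assms])

lemma differential_scale:
  assumes "u \<in> tangent_space A x" "smooth_fun A f" "\<And>i. smooth_fun A (\<lambda>y. F y $ i)"
  shows "differential (\<lambda>y. f y *\<^sub>R F y) u = u f *\<^sub>R F x + f x *\<^sub>R differential F u"
  by (simp add: differential_def vec_eq_iff tangent_mult[OF assms])

lemma tangent_inner:
  assumes "u \<in> tangent_space A x" "\<And>i. smooth_fun A (\<lambda>y. F y $ i)" "\<And>i. smooth_fun A (\<lambda>y. G y $ i)"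
  shows "u (\<lambda>y. F y \<bullet> G y) = differential F u \<bullet> G x + F x \<bullet> differential G u"
proof -
  have "u (\<lambda>y. \<Sum>i\<in>UNIV. F y $ i * G y $ i) = (\<Sum>i\<in>UNIV. u (\<lambda>y. F y $ i * G y $ i))"
    using assms by (intro tangent_sum) auto
  then show ?thesis
    using assms by (simp add: inner_vec_def differential_def tangent_mult[OF assms(1)] sum.distrib mult.commute)
qed

lemma smooth_vfield_scale:
  "smooth_fun A f \<Longrightarrow> smooth_vfield A V \<Longrightarrow> smooth_vfield A (\<lambda>x. f x *\<^sub>R V x)"
  by (auto simp: smooth_vfield_def subspace_scale[OF subspace_tangent_space])

lemma smooth_vfield_sum:
  "(\<And>i. i \<in> I \<Longrightarrow> smooth_vfield A (V i)) \<Longrightarrow> smooth_vfield A (\<lambda>x. \<Sum>i\<in>I. V i x)"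
  by (auto simp: smooth_vfield_def sum_fun_apply intro!: subspace_sum[OF subspace_tangent_space])

lemma smooth_vfield_tangent: "smooth_vfield A V \<Longrightarrow> V x \<in> tangent_space A x"
  by (simp add: smooth_vfield_def)

lemma connection_sum:
  assumes D: "connection A D" and u: "u \<in> tangent_space A x"
    and fZ: "finite I" "\<And>i. i \<in> I \<Longrightarrow> smooth_fun A (f i)" "\<And>i. i \<in> I \<Longrightarrow> smooth_vfield A (Z i)"
  shows "D (\<lambda>y. \<Sum>i\<in>I. f i y *\<^sub>R Z i y) x u = (\<Sum>i\<in>I. u (f i) *\<^sub>R Z i x + f i x *\<^sub>R D (Z i) x u)"
  using fZ
proof (induction I rule: finite_induct)
  case empty
  \<comment> \<open>The empty sum requires \<open>D\<close> to kill the zero field, which is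
    additivity applied to \<open>0 + 0\<close>.\<close>
  have "smooth_vfield A (\<lambda>_. 0)"
    using smooth_vfield_sum[of "{}"] by simp
  then have "D (\<lambda>y. 0 + 0) x u = D (\<lambda>y. 0) x u + D (\<lambda>y. 0) x u"
    by (intro connection_add[OF D _ _ u])
  then have "D (\<lambda>y. 0) x u = 0"
    by simp
  then show ?case
    by (simp only: sum.empty)
next
  case (insert i I)
  have s: "smooth_vfield A (\<lambda>y. f i y *\<^sub>R Z i y)" "smooth_vfield A (\<lambda>y. \<Sum>i\<in>I. f i y *\<^sub>R Z i y)"
    using insert.prems by (auto intro!: smooth_vfield_sum smooth_vfield_scale)
  have "D (\<lambda>y. f i y *\<^sub>R Z i y + (\<Sum>i\<in>I. f i y *\<^sub>R Z i y)) x u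
      = D (\<lambda>y. f i y *\<^sub>R Z i y) x u + D (\<lambda>y. \<Sum>i\<in>I. f i y *\<^sub>R Z i y) x u"
    using s by (intro connection_add[OF D _ _ u])
  moreover have "D (\<lambda>y. f i y *\<^sub>R Z i y) x u = u (f i) *\<^sub>R Z i x + f i x *\<^sub>R D (Z i) x u"
    using insert.prems by (intro connection_scale[OF D _ _ u]) auto
  moreover have "D (\<lambda>y. \<Sum>i\<in>I. f i y *\<^sub>R Z i y) x u
      = (\<Sum>i\<in>I. u (f i) *\<^sub>R Z i x + f i x *\<^sub>R D (Z i) x u)"
    using insert.prems by (intro insert.IH) auto
  ultimately show ?case
    by (simp only: sum.insert[OF insert.hyps])
qed

end

section \<open>The induced metric and the adjoint of \<open>X\<close>\<close>

locale surjective_family = smooth_manifold A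
  for A :: "('a::{t2_space, second_countable_topology}, 'e::euclidean_space) chart set" +
  fixes X :: "'a \<Rightarrow> real^'m \<Rightarrow> 'a tvec"
  assumes X_linear: "linear (X x)"
    and X_surj: "range (X x) = tangent_space A x"
    and X_smooth: "smooth_vfield A (\<lambda>x. X x e)"
begin

abbreviation "g \<equiv> induced_metric X"
abbreviation "Y \<equiv> adjoint_form X"
abbreviation "T \<equiv> tangent_space A"
abbreviation "Z\<^sub>X \<equiv> Z_field X"
abbreviation "frame i \<equiv> (\<lambda>x. X x (axis i 1))"

lemma X_in_tangent_space [simp]: "X x e \<in> T x"
  using X_surj by auto

text \<open>The kernel and its orthogonal complement span \<open>R^m\<close> and meet only in 0.
  This makes the \<open>inv_into\<close> of \<open>induced_metric\<close> a true inverse on the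
  tangent space.\<close>

lemma bij_betw_orthogonal_comp:
  "bij_betw (X x) (orthogonal_comp {e. X x e = 0}) (T x)"
proof -
  let ?K = "{e. X x e = 0}"
  have K: "subspace ?K"
    using X_linear by (simp add: linear_subspace_kernel)
  have "inj_on (X x) (orthogonal_comp ?K)"
  proof (rule inj_onI)
    fix a b assume ab: "a \<in> orthogonal_comp ?K" "b \<in> orthogonal_comp ?K" "X x a = X x b"
    then have "a - b \<in> ?K \<inter> orthogonal_comp ?K"
      by (simp add: linear_diff[OF X_linear] subspace_diff[OF subspace_orthogonal_comp])
    then show "a = b"
      using orthogonal_Int_0[OF K] by auto
  qed
  moreover have "X x ` orthogonal_comp ?K = T x"
  proof -
    have "\<exists>h\<in>orthogonal_comp ?K. X x h = X x e" for e
    proof -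
      have "e \<in> ?K + orthogonal_comp ?K"
        using subspace_sum_orthogonal_comp[OF K] by simp
      then obtain k h where kh: "k \<in> ?K" "h \<in> orthogonal_comp ?K" "e = k + h"
        by (rule set_plus_elim)
      then have "X x h = X x e"
        by (simp add: linear_add[OF X_linear])
      then show ?thesis
        using kh by blast
    qed
    then have "range (X x) \<subseteq> X x ` orthogonal_comp ?K"
      by (metis image_eqI image_subsetI)
    then show ?thesis
      using X_surj by auto
  qed
  ultimately show ?thesis
    by (simp add: bij_betw_def)
qed

text \<open>The adjoint is the inverse of \<open>X x\<close> restricted to the orthogonal complement
  of its kernel. From here on the three facts replace the definitions by \<open>inv_into\<close> and
  \<open>THE\<close>.\<close>

lemma induced_metric_adjoint:
  fixes v :: "'a tvec"
  assumes v: "v \<in> T x"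
  shows adjoint_in_orthogonal_comp: "Y x v \<in> orthogonal_comp {e. X x e = 0}"
    and X_adjoint: "X x (Y x v) = v"
    and induced_metric_X: "g x (X x e) v = e \<bullet> Y x v"
proof -
  let ?H = "orthogonal_comp {e. X x e = 0}"
  let ?Y = "inv_into ?H (X x)"
  have H: "?Y u \<in> ?H" "X x (?Y u) = u" if "u \<in> T x" for u
    using that bij_betw_orthogonal_comp[of x]
    by (auto simp: bij_betw_def intro: inv_into_into f_inv_into_f)
  have g: "g x (X x e) v = e \<bullet> ?Y v" for e
  proof -
    \<comment> \<open>\<open>e\<close> and \<open>?Y (X x e)\<close> differ by a kernel element,
      which is orthogonal to \<open>?Y v\<close>.\<close>
    have "X x (e - ?Y (X x e)) = 0"
      using H(2)[of "X x e"] by (simp add: linear_diff[OF X_linear])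
    then have "(e - ?Y (X x e)) \<bullet> ?Y v = 0"
      using H(1)[OF v] by (auto simp: orthogonal_comp_def orthogonal_def)
    then show ?thesis
      by (simp add: induced_metric_def Let_def inner_diff_left)
  qed
  have "Y x v = ?Y v"
    unfolding adjoint_form_def
  proof (rule the_equality)
    show "\<forall>e'. g x (X x e') v = e' \<bullet> ?Y v"
      using g by simp
    show "e = ?Y v" if "\<forall>e'. g x (X x e') v = e' \<bullet> e" for e
      using that g by (metis vector_eq_rdot inner_commute)
  qed
  then show "Y x v \<in> ?H" "X x (Y x v) = v" "g x (X x e) v = e \<bullet> Y x v"
    using H[OF v] g by auto
qed

lemma induced_metric_eq: "u \<in> T x \<Longrightarrow> v \<in> T x \<Longrightarrow> g x u v = Y x u \<bullet> Y x v"
  by (metis X_adjoint induced_metric_X)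

text \<open>Reduces linearity of \<open>Y x\<close> to linearity of \<open>X x\<close> and closure
  of the orthogonal complement under the operations.\<close>

lemma adjoint_unique:
  assumes "v \<in> T x" "e \<in> orthogonal_comp {e. X x e = 0}" "X x e = v"
  shows "Y x v = e"
  using assms bij_betw_orthogonal_comp[of x] adjoint_in_orthogonal_comp X_adjoint
  by (metis bij_betw_def inj_onD)

lemma adjoint_add: "u \<in> T x \<Longrightarrow> v \<in> T x \<Longrightarrow> Y x (u + v) = Y x u + Y x v"
  by (intro adjoint_unique)
    (auto simp: linear_add[OF X_linear] X_adjoint adjoint_in_orthogonal_comp
      intro: subspace_add[OF subspace_tangent_space] subspace_add[OF subspace_orthogonal_comp])

lemma adjoint_scale: "u \<in> T x \<Longrightarrow> Y x (c *\<^sub>R u) = c *\<^sub>R Y x u"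
  by (intro adjoint_unique)
    (auto simp: linear_scale[OF X_linear] X_adjoint adjoint_in_orthogonal_comp
      intro: subspace_scale[OF subspace_tangent_space] subspace_scale[OF subspace_orthogonal_comp])

lemma adjoint_diff: "u \<in> T x \<Longrightarrow> v \<in> T x \<Longrightarrow> Y x (u - v) = Y x u - Y x v"
  using adjoint_add[of u x "(-1) *\<^sub>R v"] adjoint_scale[of v x "-1"]
  by (simp add: subspace_scale[OF subspace_tangent_space] subspace_neg[OF subspace_tangent_space])

lemma adjoint_eq_0: "u \<in> T x \<Longrightarrow> Y x u = 0 \<Longrightarrow> u = 0"
  using X_adjoint[of u x] by (simp add: linear_0[OF X_linear])

text \<open>Writes any field \<open>X x (F x)\<close> in the global fields \<open>frame i\<close>,
  with the coordinates of \<open>F\<close> as coefficients; this takes the place of a local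
  basis.\<close>

lemma X_expand: "X x e = (\<Sum>i\<in>UNIV. e $ i *\<^sub>R frame i x)"
  by (subst basis_expansion[symmetric, of e])
    (simp add: linear_sum[OF X_linear] linear_scale[OF X_linear] scalar_mult_eq_scaleR)

lemma smooth_vfield_X:
  assumes "\<And>i. smooth_fun A (\<lambda>x. F x $ i)"
  shows "smooth_vfield A (\<lambda>x. X x (F x))"
  using smooth_vfield_sum[of UNIV "\<lambda>i x. F x $ i *\<^sub>R frame i x"]
  by (simp add: smooth_vfield_scale assms X_smooth flip: X_expand)

lemma smooth_Z_field: "smooth_vfield A (Z\<^sub>X x v)"
  by (simp add: Z_field_def X_smooth)

lemma Z_field_self: "v \<in> T x \<Longrightarrow> Z\<^sub>X x v x = v"
  by (simp add: Z_field_def X_adjoint)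

lemma metric_scale_left:
  assumes "u \<in> T x" "v \<in> T x"
  shows "g x (c *\<^sub>R u) v = c * g x u v"
  using assms by (simp add: induced_metric_eq adjoint_scale subspace_scale[OF subspace_tangent_space])

lemma metric_add_left:
  assumes "u \<in> T x" "v \<in> T x" "w \<in> T x"
  shows "g x (u + v) w = g x u w + g x v w"
  using assms by (simp add: induced_metric_eq adjoint_add inner_add_left subspace_add[OF subspace_tangent_space])

lemma metric_diff_left:
  assumes "u \<in> T x" "v \<in> T x" "w \<in> T x"
  shows "g x (u - v) w = g x u w - g x v w"
  using assms by (simp add: induced_metric_eq adjoint_diff inner_diff_left subspace_diff[OF subspace_tangent_space])

lemma metric_sym: "u \<in> T x \<Longrightarrow> v \<in> T x \<Longrightarrow> g x u v = g x v u"
  by (simp add: induced_metric_eq inner_commute)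

lemma metric_zero_left: "v \<in> T x \<Longrightarrow> g x 0 v = 0"
  using metric_scale_left[of v x v 0] by simp

lemma metric_zero_right: "v \<in> T x \<Longrightarrow> g x v 0 = 0"
  using metric_sym[of v x 0] metric_zero_left subspace_0[OF subspace_tangent_space] by metis

lemma metric_eq_0:
  assumes "u \<in> T x" "\<And>w. w \<in> T x \<Longrightarrow> g x u w = 0"
  shows "u = 0"
  using assms(2)[OF assms(1)] assms(1) by (simp add: induced_metric_eq adjoint_eq_0)

end

text \<open>The simplifier applies these rules also to unapplied sums and multiples of tangent vectors, by
  eta-expansion.\<close>

declare plus_fun_apply [simp del] zero_fun_apply [simp del] scaleR_fun_apply [simp del]
  minus_apply [simp del] uminus_apply [simp del]

section \<open>The breve connection measured against the Levi-Civita connection\<close>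

locale levi_civita_family = surjective_family A X
  for A :: "('a::{t2_space, second_countable_topology}, 'e::euclidean_space) chart set"
    and X :: "'a \<Rightarrow> real^'m \<Rightarrow> 'a tvec" +
  fixes D :: "'a cov_deriv"
  assumes LC: "levi_civita A (induced_metric X) D"
begin

abbreviation "B \<equiv> breve_connection X"
abbreviation "S x u v \<equiv> D (Z\<^sub>X x v) x u"

lemma D_connection: "connection A D"
  and D_metric: "metric_connection A g D"
  and D_torsion: "smooth_vfield A U \<Longrightarrow> smooth_vfield A V \<Longrightarrow> torsion_field D U V x = 0"
  using LC by (auto simp: levi_civita_def)

lemma lie_bracket_eq:
  assumes "smooth_vfield A U" "smooth_vfield A V"
  shows "lie_bracket U V x = D V x (U x) - D U x (V x)"
  using D_torsion[OF assms, of x] by (simp add: torsion_field_def)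

lemma D_in_tangent_space: "smooth_vfield A V \<Longrightarrow> u \<in> T x \<Longrightarrow> D V x u \<in> T x"
  using D_connection by (simp add: connection_def)

text \<open>Torsion-freeness of \<open>D\<close> writes the bracket as a difference of covariant
  derivatives, so its derivation property need not be computed.\<close>

lemma lie_bracket_in_tangent_space:
  assumes "smooth_vfield A U" "smooth_vfield A V"
  shows "lie_bracket U V x \<in> T x"
  unfolding lie_bracket_eq[OF assms]
  by (intro subspace_diff[OF subspace_tangent_space] D_in_tangent_space smooth_vfield_tangent assms)

text \<open>If \<open>h = \<langle>Z, W\<rangle>\<close> were not smooth, every tangent vector would vanish on \<open>h\<close>. Comparing
  metricity for \<open>Z\<close> and \<open>f Z\<close>, where \<open>f\<close> may be replaced by \<open>f + 1\<close> to make \<open>f h\<close> non-smooth,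
  gives \<open>u(f) h(x) = 0\<close> for all \<open>u\<close> and \<open>f\<close>, and hence \<open>h = 0\<close>.\<close>

lemma smooth_metric:
  assumes Z: "smooth_vfield A Z" and W: "smooth_vfield A W"
  shows "smooth_fun A (\<lambda>y. g y (Z y) (W y))"
proof (rule ccontr)
  let ?h = "\<lambda>y. g y (Z y) (W y)"
  assume ns: "\<not> smooth_fun A ?h"
  note T = smooth_vfield_tangent[OF Z] smooth_vfield_tangent[OF W]
  have *: "u f * ?h x = 0" if f: "smooth_fun A f" "\<not> smooth_fun A (\<lambda>y. f y * ?h y)" and u: "u \<in> T x" for u x f
  proof -
    have fZ: "smooth_vfield A (\<lambda>y. f y *\<^sub>R Z y)"
      using f Z by (intro smooth_vfield_scale)
    have "u (\<lambda>y. g y (f y *\<^sub>R Z y) (W y))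
        = g x (D (\<lambda>y. f y *\<^sub>R Z y) x u) (W x) + g x (f x *\<^sub>R Z x) (D W x u)"
      using metric_connectionD[OF D_metric fZ W u] .
    also have "D (\<lambda>y. f y *\<^sub>R Z y) x u = u f *\<^sub>R Z x + f x *\<^sub>R D Z x u"
      using connection_scale[OF D_connection f(1) Z u] .
    also have "g x (u f *\<^sub>R Z x + f x *\<^sub>R D Z x u) (W x) + g x (f x *\<^sub>R Z x) (D W x u)
        = u f * ?h x + f x * (g x (D Z x u) (W x) + g x (Z x) (D W x u))"
      using u Z W T by (simp add: metric_add_left metric_scale_left D_in_tangent_space
          subspace_scale[OF subspace_tangent_space] algebra_simps)
    also have "g x (D Z x u) (W x) + g x (Z x) (D W x u) = u ?h"
      using metric_connectionD[OF D_metric Z W u] ..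
    also have "u ?h = 0"
      using tangent_not_smooth[OF u ns] .
    finally have "u f * ?h x = u (\<lambda>y. f y * ?h y)"
      using T by (simp add: metric_scale_left)
    also have "\<dots> = 0"
      using tangent_not_smooth[OF u f(2)] .
    finally show ?thesis .
  qed
  have **: "u f * ?h x = 0" if f: "smooth_fun A f" and u: "u \<in> T x" for u x f
  proof (cases "smooth_fun A (\<lambda>y. f y * ?h y)")
    case True
    have "\<not> smooth_fun A (\<lambda>y. (f y + 1) * ?h y)"
    proof
      assume "smooth_fun A (\<lambda>y. (f y + 1) * ?h y)"
      then have "smooth_fun A (\<lambda>y. (f y + 1) * ?h y + (-1) * (f y * ?h y))"
        by (intro smooth_fun_add smooth_fun_mult[of "\<lambda>_. -1"] smooth_fun_const True)
      moreover have "(\<lambda>y. (f y + 1) * ?h y + (-1) * (f y * ?h y)) = ?h"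
        by (simp add: algebra_simps)
      ultimately show False
        using ns by simp
    qed
    then have "u (\<lambda>y. f y + 1) * ?h x = 0"
      by (intro *[OF smooth_fun_add[OF f smooth_fun_const] _ u])
    then show ?thesis
      using tangent_add[OF u f smooth_fun_const, of 1] tangent_const[OF u, of 1] by simp
  qed (rule *[OF f _ u])
  have "?h x = 0" for x
  proof (rule ccontr)
    assume h: "?h x \<noteq> 0"
    have "Z x f = 0" for f
    proof (cases "smooth_fun A f")
      case True
      then show ?thesis
        using **[OF True T(1)[of x]] h by simp
    qed (rule tangent_not_smooth[OF T(1)])
    then have "Z x = 0"
      by (simp add: fun_eq_iff zero_fun_apply)
    then show False
      using h metric_scale_left[OF T, of x 0] by simp
  qed
  then have "?h = (\<lambda>_. 0)" ..
  then show False
    using ns by (simp add: smooth_fun_const)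
qed

text \<open>The coordinates of \<open>Y V\<close> are the inner products of \<open>V\<close> with
  the \<open>frame\<close> fields, so smoothness of the metric suffices.\<close>

lemma smooth_adjoint:
  assumes "smooth_vfield A V"
  shows "smooth_fun A (\<lambda>y. Y y (V y) $ i)"
proof -
  have "Y y (V y) $ i = g y (frame i y) (V y)" for y
    using smooth_vfield_tangent[OF assms, of y]
    by (simp add: induced_metric_X inner_axis')
  then show ?thesis
    using smooth_metric[OF X_smooth assms] by simp
qed

text \<open>\<open>V\<close> and \<open>Z_field X x (V x)\<close> are combinations of the same
  frame, the second with the coefficients of the first frozen at \<open>x\<close>. In the difference
  of their derivatives the terms with \<open>D (frame i) x u\<close> cancel; what remains is
  \<open>X x\<close> applied to the derivative of the coefficients.\<close>

lemma breve_eq: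
  assumes V: "smooth_vfield A V" and u: "u \<in> T x"
  shows "B V x u = D V x u - S x u (V x)"
proof -
  have V_eq: "(\<lambda>y. \<Sum>i\<in>UNIV. Y y (V y) $ i *\<^sub>R frame i y) = V"
    using X_adjoint[OF smooth_vfield_tangent[OF V]] by (simp flip: X_expand)
  have Z_eq: "(\<lambda>y. \<Sum>i\<in>UNIV. Y x (V x) $ i *\<^sub>R frame i y) = Z\<^sub>X x (V x)"
    by (simp add: Z_field_def flip: X_expand)
  have "D (\<lambda>y. \<Sum>i\<in>UNIV. Y y (V y) $ i *\<^sub>R frame i y) x u
      = (\<Sum>i\<in>UNIV. u (\<lambda>y. Y y (V y) $ i) *\<^sub>R frame i x + Y x (V x) $ i *\<^sub>R D (frame i) x u)"
    by (intro connection_sum[OF D_connection u] finite smooth_adjoint V X_smooth)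
  moreover have "D (\<lambda>y. \<Sum>i\<in>UNIV. Y x (V x) $ i *\<^sub>R frame i y) x u
      = (\<Sum>i\<in>UNIV. u (\<lambda>y. Y x (V x) $ i) *\<^sub>R frame i x + Y x (V x) $ i *\<^sub>R D (frame i) x u)"
    by (intro connection_sum[OF D_connection u] finite smooth_fun_const X_smooth)
  moreover have "B V x u = (\<Sum>i\<in>UNIV. u (\<lambda>y. Y y (V y) $ i) *\<^sub>R frame i x)"
    using X_expand[of x "differential (\<lambda>y. Y y (V y)) u"]
    by (simp add: breve_connection_def differential_def)
  ultimately show ?thesis
    unfolding V_eq Z_eq by (simp add: tangent_const[OF u] sum.distrib)
qed

text \<open>Through \<open>Y\<close> the metric becomes the dot product of \<open>R^m\<close>, which
  obeys the Leibniz rule; the adjoint relation turns each \<open>differential\<close> into a breve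
  derivative.\<close>

lemma breve_metric: "metric_connection A g B"
  unfolding metric_connection_def
proof (intro allI impI ballI)
  fix Z W x u assume Z: "smooth_vfield A Z" and W: "smooth_vfield A W" and u: "u \<in> T x"
  note T = smooth_vfield_tangent[OF Z] smooth_vfield_tangent[OF W]
  have "u (\<lambda>y. g y (Z y) (W y)) = u (\<lambda>y. Y y (Z y) \<bullet> Y y (W y))"
    using T by (simp add: induced_metric_eq)
  also have "\<dots> = differential (\<lambda>y. Y y (Z y)) u \<bullet> Y x (W x) + Y x (Z x) \<bullet> differential (\<lambda>y. Y y (W y)) u"
    using tangent_inner[OF u smooth_adjoint[OF Z] smooth_adjoint[OF W]] .
  finally show "u (\<lambda>y. g y (Z y) (W y)) = g x (B Z x u) (W x) + g x (Z x) (B W x u)"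
    using T by (simp add: breve_connection_def induced_metric_X metric_sym[of "Z x"] inner_commute)
qed

lemma breve_is_connection: "connection A B"
proof -
  have "B Z x (u + w) = B Z x u + B Z x w" for Z x u w
  proof -
    have "differential F (u + w) = differential F u + differential F w" for F :: "'a \<Rightarrow> real^'m"
      by (simp add: differential_def vec_eq_iff plus_fun_apply)
    then show ?thesis
      by (simp add: breve_connection_def linear_add[OF X_linear])
  qed
  moreover have "B Z x (c *\<^sub>R u) = c *\<^sub>R B Z x u" for Z x u c
  proof -
    have "differential F (c *\<^sub>R u) = c *\<^sub>R differential F u" for F :: "'a \<Rightarrow> real^'m"
      by (simp add: differential_def vec_eq_iff scaleR_fun_apply)
    then show ?thesis
      by (simp add: breve_connection_def linear_scale[OF X_linear])
  qed
  moreover have "B (\<lambda>y. Z y + W y) x u = B Z x u + B W x u"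
    if "smooth_vfield A Z" "smooth_vfield A W" "u \<in> T x" for Z W x u
    using that
    by (simp add: breve_connection_def adjoint_add smooth_vfield_tangent differential_add smooth_adjoint
        linear_add[OF X_linear])
  \<comment> \<open>In the Leibniz term \<open>X x (Y x (Z x))\<close> gives back
    \<open>Z x\<close>.\<close>
  moreover have "B (\<lambda>y. f y *\<^sub>R Z y) x u = u f *\<^sub>R Z x + f x *\<^sub>R B Z x u"
    if "smooth_fun A f" "smooth_vfield A Z" "u \<in> T x" for f Z x u
    using that
    by (simp add: breve_connection_def adjoint_scale smooth_vfield_tangent differential_scale smooth_adjoint
        linear_add[OF X_linear] linear_scale[OF X_linear] X_adjoint)
  moreover have "smooth_vfield A (\<lambda>x. B Z x (U x))" if "smooth_vfield A U" "smooth_vfield A Z" for U Z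
    unfolding breve_connection_def
    by (intro smooth_vfield_X)
      (use that smooth_adjoint in \<open>auto simp: differential_def smooth_vfield_def\<close>)
  moreover have "B Z x u \<in> T x" for Z x u
    by (simp add: breve_connection_def)
  ultimately show ?thesis
    by (simp add: connection_def)
qed

lemma S_in_tangent_space: "u \<in> T x \<Longrightarrow> S x u v \<in> T x"
  by (simp add: D_in_tangent_space smooth_Z_field)

text \<open>The field \<open>Z_field X x v\<close> has zero breve derivative at \<open>x\<close>, by
  \<open>breve_eq\<close> for that very field. As the breve connection is metric, the inner product
  of two such fields has derivative zero at \<open>x\<close>; metricity of \<open>D\<close> expands
  this zero.\<close>

lemma S_skew:
  assumes "u \<in> T x" "v \<in> T x" "w \<in> T x"
  shows "g x (S x u v) w = - g x (S x u w) v"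
proof -
  have B: "B (Z\<^sub>X x v) x u = 0" if "v \<in> T x" for v
    using breve_eq[OF smooth_Z_field assms(1), of x v] Z_field_self[OF that] by simp
  have "u (\<lambda>y. g y (Z\<^sub>X x v y) (Z\<^sub>X x w y)) = 0"
    using metric_connectionD[OF breve_metric smooth_Z_field[of x v] smooth_Z_field[of x w] assms(1)] assms
    by (simp add: B Z_field_self metric_zero_left metric_zero_right)
  moreover have "u (\<lambda>y. g y (Z\<^sub>X x v y) (Z\<^sub>X x w y)) = g x (S x u v) w + g x v (S x u w)"
    using metric_connectionD[OF D_metric smooth_Z_field[of x v] smooth_Z_field[of x w] assms(1)] assms
    by (simp only: Z_field_self)
  moreover have "g x v (S x u w) = g x (S x u w) v"
    using assms by (intro metric_sym S_in_tangent_space)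
  ultimately show ?thesis
    by simp
qed

lemma torsion_field_breve:
  assumes "smooth_vfield A U" "smooth_vfield A V"
  shows "torsion_field B U V x = S x (V x) (U x) - S x (U x) (V x)"
proof -
  \<comment> \<open>\<open>a\<close> and \<open>b\<close> stand for the \<open>D\<close>
    derivatives, whose difference is the bracket; \<open>s\<close> and \<open>t\<close> are the
    corrections from \<open>breve_eq\<close>.\<close>
  have "(a - s) - (b - t) - (a - b) = t - s" for a b s t :: "'a tvec"
    by (simp add: algebra_simps)
  then show ?thesis
    using assms by (simp only: torsion_field_def breve_eq smooth_vfield_tangent lie_bracket_eq)
qed

text \<open>By \<open>torsion_field_breve\<close> only the values of \<open>U\<close> and
  \<open>V\<close> at \<open>x\<close> matter, so the definite description has a solution; the
  \<open>Z_field\<close> extensions make it unique.\<close>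

lemma torsion_breve:
  assumes "u \<in> T x" "v \<in> T x"
  shows "torsion A B x u v = S x v u - S x u v"
  unfolding torsion_def
proof (rule the_equality)
  show "t = S x v u - S x u v"
    if "\<forall>U V. smooth_vfield A U \<longrightarrow> smooth_vfield A V \<longrightarrow> U x = u \<longrightarrow> V x = v \<longrightarrow> t = torsion_field B U V x" for t
    using that[rule_format, of "Z\<^sub>X x u" "Z\<^sub>X x v"] assms
    by (simp add: smooth_Z_field Z_field_self torsion_field_breve)
qed (auto simp: torsion_field_breve)

section \<open>Levi-Civita and torsion skew symmetry as symmetries of \<open>S\<close>\<close>

text \<open>The breve connection is always metric, so its torsion decides; \<open>Z_field\<close>
  extensions test it on arbitrary pairs of vectors.\<close>

lemma levi_civita_breve_iff_symmetric:
  "levi_civita A g B \<longleftrightarrow> (\<forall>x. \<forall>u\<in>T x. \<forall>v\<in>T x. S x u v = S x v u)"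
proof
  assume LC: "levi_civita A g B"
  show "\<forall>x. \<forall>u\<in>T x. \<forall>v\<in>T x. S x u v = S x v u"
  proof (intro allI ballI)
    fix x u v assume "u \<in> T x" "v \<in> T x"
    moreover have "torsion_field B (Z\<^sub>X x v) (Z\<^sub>X x u) x = 0"
      using LC smooth_Z_field unfolding levi_civita_def by blast
    ultimately show "S x u v = S x v u"
      by (simp add: torsion_field_breve smooth_Z_field Z_field_self)
  qed
next
  assume "\<forall>x. \<forall>u\<in>T x. \<forall>v\<in>T x. S x u v = S x v u"
  then show "levi_civita A g B"
    by (simp add: levi_civita_def breve_is_connection breve_metric torsion_field_breve smooth_vfield_tangent)
qed

text \<open>A trilinear form that is symmetric in its first two arguments and skew in its last two is zero.\<close>

lemma S_eq_0_iff_symmetric: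
  "(\<forall>v\<in>T x. \<forall>u\<in>T x. S x u v = 0) \<longleftrightarrow> (\<forall>u\<in>T x. \<forall>v\<in>T x. S x u v = S x v u)"
proof
  assume sym: "\<forall>u\<in>T x. \<forall>v\<in>T x. S x u v = S x v u"
  show "\<forall>v\<in>T x. \<forall>u\<in>T x. S x u v = 0"
  proof (intro ballI metric_eq_0)
    fix u v w assume "u \<in> T x" "v \<in> T x" "w \<in> T x"
    then show "g x (S x u v) w = 0"
      using sym S_skew[of u x v w] S_skew[of v x w u] S_skew[of w x u v] by simp
  qed (rule S_in_tangent_space)
qed simp

text \<open>The torsion is \<open>S x v u - S x u v\<close>, and its first term is already skew as a
  map of \<open>u\<close> by \<open>S_skew\<close>.\<close>

lemma torsion_skew_iff_skew:
  "torsion_skew_symmetric A g B \<longleftrightarrow> (\<forall>x. \<forall>v\<in>T x. skew_symmetric_on (T x) (g x) (\<lambda>u. S x u v))"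
proof -
  have "g x (torsion A B x u v) w = - g x u (torsion A B x w v) \<longleftrightarrow> g x (S x u v) w = - g x u (S x w v)"
    if "u \<in> T x" "v \<in> T x" "w \<in> T x" for x u v w
    using that S_skew[of v x u w]
    by (auto simp: torsion_breve metric_sym[of u] metric_diff_left S_in_tangent_space
        subspace_diff[OF subspace_tangent_space])
  then show ?thesis
    unfolding torsion_skew_symmetric_def skew_symmetric_on_def by blast
qed

text \<open>Let s(u,v,w) be \<open>g x (S x u v) w\<close>. It is skew in its last two arguments,
  and conjugating by their exchange turns skewness in the first and third arguments into skewness in
  the first two.\<close>

lemma skew_iff_antisymmetric:
  "(\<forall>v\<in>T x. skew_symmetric_on (T x) (g x) (\<lambda>u. S x u v))
    \<longleftrightarrow> (\<forall>v\<in>T x. \<forall>w\<in>T x. S x v w + S x w v = 0)"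
proof
  assume sk: "\<forall>v\<in>T x. skew_symmetric_on (T x) (g x) (\<lambda>u. S x u v)"
  have sk': "g x (S x u v) w = - g x (S x w v) u" if "u \<in> T x" "v \<in> T x" "w \<in> T x" for u v w
    using sk that by (simp add: skew_symmetric_on_def metric_sym[of u] S_in_tangent_space)
  show "\<forall>v\<in>T x. \<forall>w\<in>T x. S x v w + S x w v = 0"
  proof (intro ballI metric_eq_0)
    fix v w u assume "v \<in> T x" "w \<in> T x" "u \<in> T x"
    then show "g x (S x v w + S x w v) u = 0"
      \<comment> \<open>The chain is s(v,w,u) = -s(v,u,w) = s(w,u,v) = -s(w,v,u).\<close>
      using S_skew[of v x w u] sk'[of v u w] S_skew[of w x u v]
      by (simp add: metric_add_left S_in_tangent_space)
  qed (intro subspace_add[OF subspace_tangent_space] S_in_tangent_space)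
next
  assume anti: "\<forall>v\<in>T x. \<forall>w\<in>T x. S x v w + S x w v = 0"
  have anti': "g x (S x u v) w = - g x (S x v u) w" if "u \<in> T x" "v \<in> T x" "w \<in> T x" for u v w
    using that anti metric_add_left[of "S x u v" x "S x v u" w] metric_zero_left[of w x]
    by (simp add: S_in_tangent_space)
  show "\<forall>v\<in>T x. skew_symmetric_on (T x) (g x) (\<lambda>u. S x u v)"
    unfolding skew_symmetric_on_def
  proof (intro ballI)
    fix v u w assume "v \<in> T x" "u \<in> T x" "w \<in> T x"
    then show "g x (S x u v) w = - g x u (S x w v)"
      using anti'[of u v w] S_skew[of v x u w] anti'[of v w u]
      by (simp add: metric_sym[of u] S_in_tangent_space)
  qed
qed

text \<open>By \<open>breve_eq\<close> the two symmetrised derivatives differ by the symmetrisation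
  of \<open>S\<close> at the values of \<open>U\<close> and \<open>V\<close>; \<open>Z_field\<close>
  realises every pair of values.\<close>

lemma antisymmetric_iff_breve_sym:
  "(\<forall>x. \<forall>v\<in>T x. \<forall>w\<in>T x. S x v w + S x w v = 0) \<longleftrightarrow>
   (\<forall>U V. smooth_vfield A U \<longrightarrow> smooth_vfield A V \<longrightarrow>
      (\<forall>x. B V x (U x) + B U x (V x) = D V x (U x) + D U x (V x)))" (is "?L \<longleftrightarrow> ?R")
proof -
  have *: "B V x (U x) + B U x (V x) = D V x (U x) + D U x (V x)
      \<longleftrightarrow> S x (U x) (V x) + S x (V x) (U x) = 0"
    if "smooth_vfield A U" "smooth_vfield A V" for U V x
  proof -
    have "(a - s) + (b - t) = a + b \<longleftrightarrow> s + t = 0" for a b s t :: "'a tvec"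
    proof -
      have "(a - s) + (b - t) = (a + b) - (s + t)"
        by (simp only: add_diff_add)
      then show ?thesis
        by (metis diff_0_right diff_left_imp_eq)
    qed
    then show ?thesis
      using that by (simp only: breve_eq smooth_vfield_tangent)
  qed
  show ?thesis
  proof
    show ?R if ?L
      using that by (intro allI impI) (simp only: * smooth_vfield_tangent)
    show ?L if ?R
    proof (intro allI ballI)
      fix x v w assume vw: "v \<in> T x" "w \<in> T x"
      have "S x (Z\<^sub>X x v x) (Z\<^sub>X x w x) + S x (Z\<^sub>X x w x) (Z\<^sub>X x v x) = 0"
        using that[rule_format, OF smooth_Z_field smooth_Z_field]
        by (rule *[OF smooth_Z_field smooth_Z_field, THEN iffD1])
      then show "S x v w + S x w v = 0"
        by (simp only: Z_field_self vw)
    qed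
  qed
qed

section \<open>The exterior derivative of \<open>Y\<close>\<close>

text \<open>This is the product rule for \<open>Y V = (Y X) (Y V)\<close>: differentiating
  \<open>Y V\<close> gives \<open>Y x (B V x u)\<close>, while differentiating \<open>Y X\<close>
  leaves \<open>Y V\<close> frozen at \<open>x\<close>. The second summand thus depends on
  \<open>V\<close> only through \<open>V x\<close>.\<close>

lemma differential_adjoint:
  assumes V: "smooth_vfield A V" and u: "u \<in> T x"
  shows "differential (\<lambda>y. Y y (V y)) u = Y x (B V x u) + differential (\<lambda>y. Y y (Z\<^sub>X x (V x) y)) u"
proof -
  note TV = smooth_vfield_tangent[OF V]
  define F where "F = (\<lambda>y. Y y (V y))"
  \<comment> \<open>\<open>P j y\<close> is column \<open>j\<close> of the matrix of
    \<open>Y y\<close> after \<open>X y\<close>, the orthogonal projection along the kernel of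
    \<open>X y\<close>. The matrix is symmetric (\<open>sym\<close>), so in \<open>YX\<close> its
    columns serve as rows.\<close>
  define P where "P = (\<lambda>j y. Y y (frame j y))"
  have F: "smooth_fun A (\<lambda>y. F y $ i)" for i
    using smooth_adjoint[OF V] by (simp add: F_def)
  have P: "smooth_fun A (\<lambda>y. P j y $ i)" for i j
    using smooth_adjoint[OF X_smooth] by (simp add: P_def)
  have sym: "Y y (X y e) \<bullet> a = e \<bullet> Y y (X y a)" for y e a
    by (metis X_in_tangent_space induced_metric_X inner_commute metric_sym)
  have YX: "Y y (X y e) $ i = e \<bullet> P i y" for y e i
    using sym[of y e "axis i 1"] by (simp add: P_def inner_axis)
  have "u (\<lambda>y. F y $ i) = Y x (B V x u) $ i + u (\<lambda>y. Y y (Z\<^sub>X x (V x) y) $ i)" for i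
  proof -
    have "(\<lambda>y. F y $ i) = (\<lambda>y. F y \<bullet> P i y)"
      using X_adjoint[OF TV] by (simp add: F_def flip: YX)
    then have "u (\<lambda>y. F y $ i) = differential F u \<bullet> P i x + F x \<bullet> differential (P i) u"
      using tangent_inner[OF u F P] by simp
    also have "differential F u \<bullet> P i x = Y x (B V x u) $ i"
      by (simp add: breve_connection_def F_def YX)
    \<comment> \<open>With \<open>F x\<close> held constant, only \<open>P i\<close> is
      differentiated.\<close>
    also have "F x \<bullet> differential (P i) u = u (\<lambda>y. F x \<bullet> P i y)"
      using tangent_inner[OF u smooth_fun_const P, of "F x" i] tangent_const[OF u]
      by (simp add: differential_def zero_vec_def[symmetric])
    also have "(\<lambda>y. F x \<bullet> P i y) = (\<lambda>y. Y y (Z\<^sub>X x (V x) y) $ i)"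
      by (simp add: Z_field_def YX F_def)
    finally show ?thesis .
  qed
  then show ?thesis
    by (simp add: differential_def vec_eq_iff F_def)
qed

text \<open>By \<open>r\<close> the defining expression is \<open>Y x\<close> of the torsion plus
  terms in \<open>u\<close> and \<open>v\<close> alone, so it is the same for all extensions and may
  be evaluated on \<open>Z_field\<close> extensions.\<close>

lemma X_exterior_derivative:
  assumes u: "u \<in> T x" and v: "v \<in> T x"
  shows "X x (exterior_derivative A Y x u v) = S x v u - S x u v"
proof -
  let ?r = "\<lambda>U V. differential (\<lambda>y. Y y (V y)) u - differential (\<lambda>y. Y y (U y)) v - Y x (lie_bracket U V x)"
  have r: "?r U V = Y x (S x v u - S x u v)
      + differential (\<lambda>y. Y y (Z\<^sub>X x v y)) u - differential (\<lambda>y. Y y (Z\<^sub>X x u y)) v"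
    if "smooth_vfield A U" "smooth_vfield A V" "U x = u" "V x = v" for U V
  proof -
    have "B V x u \<in> T x" "B U x v \<in> T x"
      by (simp_all add: breve_connection_def)
    then have "Y x (torsion_field B U V x) = Y x (B V x u) - Y x (B U x v) - Y x (lie_bracket U V x)"
      using that by (simp add: torsion_field_def adjoint_diff lie_bracket_in_tangent_space
          subspace_diff[OF subspace_tangent_space])
    then show ?thesis
      using that u v by (simp add: torsion_field_breve differential_adjoint algebra_simps)
  qed
  note rZ = r[OF smooth_Z_field smooth_Z_field Z_field_self[OF u] Z_field_self[OF v]]
  have "exterior_derivative A Y x u v = ?r (Z\<^sub>X x u) (Z\<^sub>X x v)"
    unfolding exterior_derivative_def
  proof (rule the_equality)
    show "\<forall>U V. smooth_vfield A U \<longrightarrow> smooth_vfield A V \<longrightarrow> U x = u \<longrightarrow> V x = v \<longrightarrow> ?r (Z\<^sub>X x u) (Z\<^sub>X x v) = ?r U V"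
    proof (intro allI impI)
      fix U V assume "smooth_vfield A U" "smooth_vfield A V" "U x = u" "V x = v"
      then show "?r (Z\<^sub>X x u) (Z\<^sub>X x v) = ?r U V"
        using r[of U V] rZ by simp
    qed
    show "s = ?r (Z\<^sub>X x u) (Z\<^sub>X x v)"
      if "\<forall>U V. smooth_vfield A U \<longrightarrow> smooth_vfield A V \<longrightarrow> U x = u \<longrightarrow> V x = v \<longrightarrow> s = ?r U V" for s
      using that[rule_format, OF smooth_Z_field smooth_Z_field Z_field_self[OF u] Z_field_self[OF v]] .
  qed
  \<comment> \<open>\<open>X x\<close> turns each \<open>differential\<close> into a breve
    derivative by definition and undoes \<open>Y x\<close> on the bracket.\<close>
  then have "X x (exterior_derivative A Y x u v) = torsion_field B (Z\<^sub>X x u) (Z\<^sub>X x v) x"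
    using u v by (simp add: torsion_field_def breve_connection_def linear_diff[OF X_linear]
        X_adjoint lie_bracket_in_tangent_space smooth_Z_field Z_field_self)
  then show ?thesis
    using u v by (simp add: torsion_field_breve smooth_Z_field Z_field_self)
qed

end

theorem proposition2p4:
  fixes A :: "('a::{t2_space, second_countable_topology}, real^'n) chart set"
    and X :: "'a \<Rightarrow> real^'m \<Rightarrow> 'a tvec"
    and D :: "'a cov_deriv"
  assumes manifold: "smooth_manifold A"
    and X_linear: "\<And>x. linear (X x)"
    and X_surj: "\<And>x. range (X x) = tangent_space A x"
    and X_smooth: "\<And>e. smooth_vfield A (\<lambda>x. X x e)"
    and LC: "levi_civita A (induced_metric X) D"
  shows
    "(levi_civita A (induced_metric X) (breve_connection X) \<longleftrightarrow>
        (\<forall>x\<^sub>0. \<forall>v\<in>tangent_space A x\<^sub>0. \<forall>u\<in>tangent_space A x\<^sub>0. D (Z_field X x\<^sub>0 v) x\<^sub>0 u = 0))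
   \<and> (torsion_skew_symmetric A (induced_metric X) (breve_connection X) \<longleftrightarrow>
        (\<forall>x\<^sub>0. \<forall>v\<in>tangent_space A x\<^sub>0.
           skew_symmetric_on (tangent_space A x\<^sub>0) (induced_metric X x\<^sub>0) (\<lambda>u. D (Z_field X x\<^sub>0 v) x\<^sub>0 u)))
   \<and> (torsion_skew_symmetric A (induced_metric X) (breve_connection X) \<longleftrightarrow>
        (\<forall>x. \<forall>v\<in>tangent_space A x. \<forall>w\<in>tangent_space A x.
           D (Z_field X x w) x v + D (Z_field X x v) x w = 0))
   \<and> (torsion_skew_symmetric A (induced_metric X) (breve_connection X) \<longleftrightarrow>
        (\<forall>U V. smooth_vfield A U \<longrightarrow> smooth_vfield A V \<longrightarrow>
           (\<forall>x. breve_connection X V x (U x) + breve_connection X U x (V x) = D V x (U x) + D U x (V x))))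
   \<and> (levi_civita A (induced_metric X) (breve_connection X) \<longleftrightarrow>
        (\<forall>x. \<forall>u\<in>tangent_space A x. \<forall>v\<in>tangent_space A x.
           X x (exterior_derivative A (adjoint_form X) x u v) = 0))"
proof -
  interpret levi_civita_family A X D
    by (intro levi_civita_family.intro surjective_family.intro surjective_family_axioms.intro
        levi_civita_family_axioms.intro assms)
  have vanishing: "levi_civita A g B \<longleftrightarrow> (\<forall>x. \<forall>v\<in>T x. \<forall>u\<in>T x. S x u v = 0)"
    unfolding levi_civita_breve_iff_symmetric S_eq_0_iff_symmetric ..
  \<comment> \<open>Both sides say that the torsion \<open>S x v u - S x u v\<close>
    vanishes.\<close>
  have "X x (exterior_derivative A Y x u v) = 0 \<longleftrightarrow> S x u v = S x v u"
    if "u \<in> T x" "v \<in> T x" for x u v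
    unfolding X_exterior_derivative[OF that] by (simp only: right_minus_eq) (rule eq_commute)
  then have exterior: "levi_civita A g B \<longleftrightarrow>
      (\<forall>x. \<forall>u\<in>T x. \<forall>v\<in>T x. X x (exterior_derivative A Y x u v) = 0)"
    unfolding levi_civita_breve_iff_symmetric by simp
  have antisymmetric: "torsion_skew_symmetric A g B \<longleftrightarrow>
      (\<forall>x. \<forall>v\<in>T x. \<forall>w\<in>T x. S x v w + S x w v = 0)"
    unfolding torsion_skew_iff_skew skew_iff_antisymmetric ..
  have symmetrized: "torsion_skew_symmetric A g B \<longleftrightarrow>
      (\<forall>U V. smooth_vfield A U \<longrightarrow> smooth_vfield A V \<longrightarrow>
        (\<forall>x. B V x (U x) + B U x (V x) = D V x (U x) + D U x (V x)))"
    using antisymmetric unfolding antisymmetric_iff_breve_sym .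
  show ?thesis
    by (intro conjI vanishing torsion_skew_iff_skew antisymmetric symmetrized exterior)
qed

end
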